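(* Let $N\in\mathbb{N}$, let $I$ be a non-empty set, let $\mathfrak{d}=(\mathfrak{d}_1,\ldots,\mathfrak{d}_N)\colon I\to\mathbb{N}^N$ be an $N$-fold dimension mapping on $I$, let $\mathfrak{w}\colon[0,\infty)\to[0,\infty)$, $\mathfrak{I}\colon I\to\mathbb{N}$, and $\mathfrak{O}\colon I\to\mathbb{N}$ be functions, let $R\in(0,\infty)$, $r_0,r_1,\ldots,r_N,\alpha_1,\ldots,\alpha_N,\rho\in[0,\infty)$, $a\in C(\mathbb{R},\mathbb{R})$, let $$f=(f_{i,n})_{(i,n)\in I\times\mathbb{N}}\in\mathcal{W}_{a,\mathfrak{w},\infty,\infty}^{r_0,r_1,\ldots,r_N,\rho}(I\times\mathbb{N},\mathfrak{d}\otimes\mathrm{id}_{\mathbb{N}})$$ and let $g=(g_i)_{i\in I}$ be a function family on $I$ such that for all $i\in I$, $n\in\mathbb{N}$ it holds that $\{f_{i,n},g_i\}\subseteq C(\mathbb{R}^{\mathfrak{I}(i)},\mathbb{R}^{\mathfrak{O}(i)})$, and assume $$\sup_{i\in I}\sup_{n\in\mathbb{N}}\sup_{x\in\mathbb{R}^{\mathfrak{I}(i)}}\left(\frac{\mathfrak{w}(\|x\|)\,\|g_i(x)-f_{i,n}(x)\|}{n^{-R}\prod_{l=1}^N|\mathfrak{d}_l(i)|^{\alpha_l}}\right)<\infty.$$ Then $g\in\mathcal{W}_{a,\mathfrak{w},\infty,\infty}^{r_0+\rho/R,\;r_1+\rho\alpha_1/R,\;\ldots,\;r_N+\rho\alp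ha_N/R}(I,\mathfrak{d})$.
   Context: $\mathbb{N}=\{1,2,3,\ldots\}$ and $\|\cdot\|$ is the Euclidean norm on every $\mathbb{R}^d$. ANNs: $\mathscr{N} = \bigcup_{L\in\mathbb{N}}\bigcup_{l_0,\ldots,l_L\in\mathbb{N}} \left(\times_{k=1}^L (\mathbb{R}^{l_k\times l_{k-1}}\times\mathbb{R}^{l_k})\right)$. For $\Phi=((W_1,B_1),\ldots,(W_L,B_L)) \in \times_{k=1}^L (\mathbb{R}^{l_k\times l_{k-1}}\times\mathbb{R}^{l_k})$: $\mathcal{P}(\Phi)=\sum_{k=1}^L l_k(l_{k-1}+1)$, and for $a\in C(\mathbb{R},\mathbb{R})$ the realization $\mathcal{R}_a(\Phi)\in C(\mathbb{R}^{l_0},\mathbb{R}^{l_L})$ is $(\mathcal{R}_a(\Phi))(x_0)=W_Lx_{L-1}+B_L$, where for $0<k<L$ the vector $x_k$ is obtained by applying $a$ componentwise to $W_kx_{k-1}+B_k$. A function family on a non-empty set $I$ is a map $f=(f_i)_{i\in I}\colon I\to\bigcup_{k,l\in\mathbb{N}}C(\mathbb{R}^k,\mathbb{R}^l)$. An $N$-fold dimension mapping on $I$ is a function $\mathfrak{d}=(\mathfrak{d}_1,\ldots,\mathfrak{d}_N)\colon I\to\mathbb{N}^N$. The $(N+1)$-fold dimension mapping $\mathfrak{d}\otimes\mathrm{id}_{\mathbb{N}}$ on $I\times\mathbb{N}$ is $(\mathfrak{d}\otimes\mathrm{id}_{\mathbb{N}})(i,n)=(\mathfrak{d}_1(i),\ldots,\mathfrak{d}_N(i),n)$.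 Approximation spaces: for an $N$-fold dimension mapping $\mathfrak{d}$ on $I$, $r_0,\ldots,r_N\in\mathbb{R}$, $a\in C(\mathbb{R},\mathbb{R})$ and $\mathfrak{w}\colon[0,\infty)\to[0,\infty)$, the set $\mathcal{W}_{a,\mathfrak{w},\infty,\infty}^{r_0,r_1,\ldots,r_N}(I,\mathfrak{d})$ consists of all function families $f=(f_i)_{i\in I}$ on $I$ for which there exists $K\in\mathbb{R}$ such that for all $i\in I$, $\varepsilon\in(0,1]$ there exist $\Phi\in\mathscr{N}$ and $m,n\in\mathbb{N}$ with $\{f_i,\mathcal{R}_a(\Phi)\}\subseteq C(\mathbb{R}^m,\mathbb{R}^n)$, $\mathcal{P}(\Phi)\le K\varepsilon^{-r_0}\prod_{l=1}^N|\mathfrak{d}_l(i)|^{r_l}$, and $\sup_{x\in\mathbb{R}^m}\big(\mathfrak{w}(\|x\|)\|f_i(x)-(\mathcal{R}_a(\Phi))(x)\|\big)\le\varepsilon$. *)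

theory Defs
  imports "HOL-Analysis.Analysis" "Jordan_Normal_Form.Matrix"
begin

no_notation vec_nth (infixl "$" 90)

section \<open>Euclidean spaces of variable dimension\<close>

text \<open>
  The dimensions vary with the index of the function family, so \<open>\<real>\<^sup>d\<close> is the set
  \<^term>\<open>carrier_vec d :: real vec set\<close> of the Jordan_Normal_Form library rather than a type.
\<close>

definition vnorm :: "real vec \<Rightarrow> real" where
  "vnorm x = L2_set (\<lambda>i. x $ i) {..<dim_vec x}"

text \<open>
  On \<^term>\<open>carrier_vec d\<close> this is \<^term>\<open>vnorm (x - y)\<close> (lemma \<open>eucl_dist_eq_vnorm\<close>); the
  explicit dimension makes it symmetric on all of \<^typ>\<open>real vec\<close>, as \<^locale>\<open>Metric_space\<close> requires.
\<close>

definition eucl_dist :: "nat \<Rightarrow> real vec \<Rightarrow> real vec \<Rightarrow> real" where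
  "eucl_dist d x y = L2_set (\<lambda>i. x $ i - y $ i) {..<d}"

definition eucl_top :: "nat \<Rightarrow> real vec topology" where
  "eucl_top d = Metric_space.mtopology (carrier_vec d) (eucl_dist d)"

lemma eucl_dist_eq_vnorm:
  assumes "x \<in> carrier_vec d" "y \<in> carrier_vec d"
  shows "eucl_dist d x y = vnorm (x - y)"
  using assms unfolding eucl_dist_def vnorm_def by (intro L2_set_cong) auto

lemma Metric_space_eucl: "Metric_space (carrier_vec d) (eucl_dist d)"
proof
  show "0 \<le> eucl_dist d x y" for x y
    by (simp add: eucl_dist_def)
  show "eucl_dist d x y = eucl_dist d y x" for x y
    by (simp add: eucl_dist_def L2_set_def power2_commute)
  show "eucl_dist d x y = 0 \<longleftrightarrow> x = y" if "x \<in> carrier_vec d" "y \<in> carrier_vec d" for x y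
    using that by (auto simp: eucl_dist_def L2_set_eq_0_iff)
  show "eucl_dist d x z \<le> eucl_dist d x y + eucl_dist d y z" for x y z
    using L2_set_triangle_ineq[of "\<lambda>i. x $ i - y $ i" "\<lambda>i. y $ i - z $ i" "{..<d}"]
    by (simp add: eucl_dist_def)
qed

text \<open>
  \<open>C(\<real>\<^sup>k, \<real>\<^sup>l)\<close>. Functions between Euclidean spaces are partial maps, so that the domain
  \<open>\<real>\<^sup>k\<close> is part of the function, as it is in set theory.
\<close>

definition cont_maps :: "nat \<Rightarrow> nat \<Rightarrow> (real vec \<rightharpoonup> real vec) set" where
  "cont_maps k l =
     {f. dom f = carrier_vec k \<and> continuous_map (eucl_top k) (eucl_top l) (\<lambda>x. the (f x))}"


section \<open>Artificial neural networks\<close>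

type_synonym layers = "(real mat \<times> real vec) list"

definition anns :: "layers set" where
  "anns = {\<Phi>. \<Phi> \<noteq> [] \<and> (\<exists>l :: nat \<Rightarrow> nat. (\<forall>k\<le>length \<Phi>. 1 \<le> l k) \<and>
     (\<forall>k<length \<Phi>. \<Phi> ! k \<in> carrier_mat (l (Suc k)) (l k) \<times> carrier_vec (l (Suc k))))}"

definition params :: "layers \<Rightarrow> nat" where
  "params \<Phi> = (\<Sum>(W, B)\<leftarrow>\<Phi>. dim_row W * (dim_col W + 1))"

fun feed :: "(real \<Rightarrow> real) \<Rightarrow> layers \<Rightarrow> real vec \<Rightarrow> real vec" where
  "feed a [] x = x"
| "feed a [(W, B)] x = W *\<^sub>v x + B"
| "feed a ((W, B) # L # \<Phi>) x = feed a (L # \<Phi>) (map_vec a (W *\<^sub>v x + B))"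

definition realization :: "(real \<Rightarrow> real) \<Rightarrow> layers \<Rightarrow> (real vec \<rightharpoonup> real vec)" where
  "realization a \<Phi> = (\<lambda>x. Some (feed a \<Phi> x)) |` carrier_vec (dim_col (fst (hd \<Phi>)))"


section \<open>Approximation spaces\<close>

definition function_family :: "'i set \<Rightarrow> ('i \<Rightarrow> real vec \<rightharpoonup> real vec) \<Rightarrow> bool" where
  "function_family I f \<longleftrightarrow> (\<forall>i\<in>I. \<exists>k\<ge>1. \<exists>l\<ge>1. f i \<in> cont_maps k l)"

text \<open>
  A family of \<open>N\<close>-tuples \<open>(\<delta>\<^sub>1(i), \<dots>, \<delta>\<^sub>N(i))\<close> is a function \<open>d\<close> with \<open>d i l = \<delta>\<^sub>l(i)\<close> for
  \<open>1 \<le> l \<le> N\<close>; its values for other \<open>l\<close> are never used. Likewise for the exponents \<open>r\<close> below.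
\<close>

definition dimension_mapping :: "nat \<Rightarrow> 'i set \<Rightarrow> ('i \<Rightarrow> nat \<Rightarrow> nat) \<Rightarrow> bool" where
  "dimension_mapping N I d \<longleftrightarrow> (\<forall>i\<in>I. \<forall>l\<in>{1..N}. 1 \<le> d i l)"

text \<open>\<open>\<delta> \<otimes> id\<^sub>\<nat>\<close> for an \<open>N\<close>-fold dimension mapping \<open>\<delta>\<close>.\<close>

definition dim_tensor_id :: "nat \<Rightarrow> ('i \<Rightarrow> nat \<Rightarrow> nat) \<Rightarrow> ('i \<times> nat \<Rightarrow> nat \<Rightarrow> nat)" where
  "dim_tensor_id N d = (\<lambda>(i, n). (d i)(Suc N := n))"

text \<open>
  \<open>approx_space a w N r I d\<close> has the exponents \<open>r 0, \<dots>, r N\<close>. The supremum may be infinite, so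
  it is taken in the extended reals.
\<close>

definition approx_space ::
  "(real \<Rightarrow> real) \<Rightarrow> (real \<Rightarrow> real) \<Rightarrow> nat \<Rightarrow> (nat \<Rightarrow> real) \<Rightarrow> 'i set \<Rightarrow> ('i \<Rightarrow> nat \<Rightarrow> nat)
    \<Rightarrow> ('i \<Rightarrow> real vec \<rightharpoonup> real vec) set" where
  "approx_space a w N r I d =
     {f. function_family I f \<and>
       (\<exists>K::real. \<forall>i\<in>I. \<forall>\<epsilon>\<in>{0<..1}. \<exists>\<Phi>\<in>anns. \<exists>m\<ge>1. \<exists>n\<ge>1.
          {f i, realization a \<Phi>} \<subseteq> cont_maps m n \<and>
          real (params \<Phi>) \<le> K * \<epsilon> powr (- r 0) * (\<Prod>l=1..N. \<bar>real (d i l)\<bar> powr r l) \<and>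
          (SUP x\<in>carrier_vec m.
             ereal (w (vnorm x) * vnorm (the (f i x) - the (realization a \<Phi> x)))) \<le> ereal \<epsilon>)}"

end

theory Submission
  imports Defs
begin

text \<open>
  To approximate \<open>g\<^sub>i\<close> up to \<open>\<epsilon>\<close>, choose \<open>n\<close> of order
  \<open>(\<epsilon>\<^sup>-\<^sup>1 \<Prod>\<^sub>l \<delta>\<^sub>l(i) powr \<alpha>\<^sub>l) powr (1/R)\<close>, so that \<open>f\<^sub>i\<^sub>,\<^sub>n\<close> is within \<open>\<epsilon>/2\<close> of \<open>g\<^sub>i\<close>, and take a
  network approximating \<open>f\<^sub>i\<^sub>,\<^sub>n\<close> up to \<open>\<epsilon>/2\<close>. Substituting this \<open>n\<close> into the factor \<open>n powr \<rho>\<close> of the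
  parameter bound produces the additional exponents.
\<close>

lemma topspace_eucl_top [simp]: "topspace (eucl_top k) = carrier_vec k"
  unfolding eucl_top_def
  by (simp add: Metric_space.topspace_mtopology Metric_space_eucl)

lemma cont_mapsD:
  assumes "h \<in> cont_maps k l"
  shows "dom h = carrier_vec k"
    and "x \<in> carrier_vec k \<Longrightarrow> the (h x) \<in> carrier_vec l"
proof -
  show "dom h = carrier_vec k"
    using assms by (simp add: cont_maps_def)
  show "the (h x) \<in> carrier_vec l" if "x \<in> carrier_vec k"
    using assms that continuous_map_image_subset_topspace[of "eucl_top k" "eucl_top l" "\<lambda>x. the (h x)"]
    by (auto simp: cont_maps_def)
qed

text \<open>The domain of a partial map fixes the input dimension, and its value at the zero vector
  fixes the output dimension. This identifies the dimensions of an approximating network with those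
  prescribed by \<open>dim_in\<close> and \<open>dim_out\<close>.\<close>

lemma cont_maps_dims_unique:
  assumes "h \<in> cont_maps k l" "h \<in> cont_maps m n"
  shows "m = k" "n = l"
proof -
  have z: "0\<^sub>v k \<in> carrier_vec k" by simp
  have "carrier_vec k = (carrier_vec m :: real vec set)"
    using cont_mapsD(1) assms by metis
  with z show m: "m = k"
    by (metis carrier_vecD)
  with z show "n = l"
    using cont_mapsD(2)[OF assms(1) z] cont_mapsD(2)[OF assms(2)] by (metis carrier_vecD)
qed

lemma vnorm_nonneg: "0 \<le> vnorm x"
  by (simp add: vnorm_def)

lemma vnorm_diff_triangle:
  assumes "x \<in> carrier_vec k" "y \<in> carrier_vec k" "z \<in> carrier_vec k"
  shows "vnorm (x - z) \<le> vnorm (x - y) + vnorm (y - z)"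
  using Metric_space.triangle[OF Metric_space_eucl assms] assms
  by (simp add: eucl_dist_eq_vnorm)

text \<open>Take \<open>n\<close> to be \<open>x powr (1 / R)\<close> rounded up. As
  \<open>1 \<le> x\<close>, rounding at most doubles the value, which costs the factor
  \<open>2 powr \<rho>\<close>.\<close>

lemma exists_nat_powr_bounds:
  fixes x R \<rho> :: real
  assumes "1 \<le> x" "0 < R" "0 \<le> \<rho>"
  shows "\<exists>n::nat. 1 \<le> n \<and> real n powr (-R) \<le> inverse x \<and>
           real n powr \<rho> \<le> 2 powr \<rho> * x powr (\<rho> / R)"
proof -
  define y where "y = x powr (1 / R)"
  have y1: "1 \<le> y"
    unfolding y_def using assms by (intro ge_one_powr_ge_zero) auto
  define n where "n = nat \<lceil>y\<rceil>"
  have n: "y \<le> real n" "real n \<le> 2 * y" "1 \<le> n"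
    using y1 unfolding n_def by linarith+
  have "real n powr (-R) \<le> y powr (-R)"
    using n y1 assms by (intro powr_mono2') auto
  also have "\<dots> = inverse x"
    using assms by (simp add: y_def powr_powr powr_minus)
  finally have "real n powr (-R) \<le> inverse x" .
  moreover have "real n powr \<rho> \<le> (2 * y) powr \<rho>"
    using n assms by (intro powr_mono2) auto
  then have "real n powr \<rho> \<le> 2 powr \<rho> * x powr (\<rho> / R)"
    using y1 by (simp add: powr_mult y_def powr_powr)
  ultimately show ?thesis using n by blast
qed

theorem proposition3p16:
  fixes N :: nat
    and I :: "'i set"
    and d :: "'i \<Rightarrow> nat \<Rightarrow> nat"
    and w :: "real \<Rightarrow> real"
    and dim_in dim_out :: "'i \<Rightarrow> nat"
    and R \<rho> :: real
    and r \<alpha> :: "nat \<Rightarrow> real"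
    and a :: "real \<Rightarrow> real"
    and f :: "'i \<times> nat \<Rightarrow> (real vec \<rightharpoonup> real vec)"
    and g :: "'i \<Rightarrow> (real vec \<rightharpoonup> real vec)"
  assumes "1 \<le> N"
    and "I \<noteq> {}"
    and "dimension_mapping N I d"
    and "w \<in> {0..} \<rightarrow> {0..}"
    and "dim_in \<in> I \<rightarrow> {1..}"
    and "dim_out \<in> I \<rightarrow> {1..}"
    and "0 < R"
    and "\<forall>l\<in>{0..N}. 0 \<le> r l"
    and "\<forall>l\<in>{1..N}. 0 \<le> \<alpha> l"
    and "0 \<le> \<rho>"
    and "continuous_on UNIV a"
    and "f \<in> approx_space a w (Suc N) (r(Suc N := \<rho>)) (I \<times> {1..}) (dim_tensor_id N d)"
    and "function_family I g"
    and "\<forall>i\<in>I. \<forall>n\<in>{1..}. {f (i, n), g i} \<subseteq> cont_maps (dim_in i) (dim_out i)"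
    and "(SUP i\<in>I. SUP n\<in>{1..}. SUP x\<in>carrier_vec (dim_in i).
            ereal (w (vnorm x) * vnorm (the (g i x) - the (f (i, n) x)) /
              (real n powr (- R) * (\<Prod>l=1..N. \<bar>real (d i l)\<bar> powr \<alpha> l)))) < \<infinity>"
  shows "g \<in> approx_space a w N
           (\<lambda>l. if l = 0 then r 0 + \<rho> / R else r l + \<rho> * \<alpha> l / R) I d"
proof -
  note dim = assms(3) and w = assms(4) and R = assms(7) and \<alpha> = assms(9)
    and \<rho> = assms(10) and f = assms(12) and g = assms(13) and fg = assms(14) and sup = assms(15)
  define D where "D i = (\<Prod>l=1..N. \<bar>real (d i l)\<bar> powr \<alpha> l)" for i
  define P where "P i = (\<Prod>l=1..N. \<bar>real (d i l)\<bar> powr r l)" for i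
  \<comment> \<open>This bound makes the denominators in \<open>fg_le\<close> positive and later
    ensures \<open>1 \<le> X\<close>.\<close>
  have D1: "1 \<le> D i" if "i \<in> I" for i
    unfolding D_def using that dim \<alpha>
    by (intro prod_ge_1 ge_one_powr_ge_zero) (auto simp: dimension_mapping_def)
  have P0: "0 \<le> P i" for i
    unfolding P_def by (intro prod_nonneg) auto
  define S where "S = (SUP i\<in>I. SUP n\<in>{1..}. SUP x\<in>carrier_vec (dim_in i).
      ereal (w (vnorm x) * vnorm (the (g i x) - the (f (i, n) x)) / (real n powr (- R) * D i)))"
  have "S < \<infinity>"
    using sup by (simp only: S_def D_def)
  then obtain c where "S \<le> ereal c"
    by (cases S) auto
  then have c: "w (vnorm x) * vnorm (the (g i x) - the (f (i, n) x)) / (real n powr (- R) * D i) \<le> c"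
    if "i \<in> I" "1 \<le> n" "x \<in> carrier_vec (dim_in i)" for i n x
    using that by (simp add: S_def SUP_le_iff)
  \<comment> \<open>The bound \<open>c\<close> may be small or even negative; enlarging it to at
    least 1 keeps \<open>X\<close> at least 1.\<close>
  define C where "C = max 1 c"
  have C1: "1 \<le> C" by (simp add: C_def)
  have fg_le: "w (vnorm x) * vnorm (the (g i x) - the (f (i, n) x)) \<le> C * D i * real n powr (- R)"
    if "i \<in> I" "1 \<le> n" "x \<in> carrier_vec (dim_in i)" for i n x
  proof -
    have "0 < real n powr (- R) * D i"
      using D1[OF that(1)] that(2) by simp
    moreover have "w (vnorm x) * vnorm (the (g i x) - the (f (i, n) x)) / (real n powr (- R) * D i) \<le> C"
      using c[OF that] by (simp add: C_def)
    ultimately show ?thesis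
      by (simp add: pos_divide_le_eq mult_ac)
  qed
  \<comment> \<open>The factor with index \<open>Suc N\<close> splits off: there the dimension is
    \<open>n\<close> and the exponent is \<open>\<rho>\<close>.\<close>
  have dtp: "(\<Prod>l=1..Suc N. \<bar>real (dim_tensor_id N d (i, n) l)\<bar> powr (r(Suc N := \<rho>)) l)
      = P i * real n powr \<rho>" for i n
  proof -
    have "(\<Prod>l=1..N. \<bar>real (dim_tensor_id N d (i, n) l)\<bar> powr (r(Suc N := \<rho>)) l) = P i"
      unfolding P_def by (intro prod.cong) (auto simp: dim_tensor_id_def)
    then show ?thesis
      by (simp add: dim_tensor_id_def)
  qed
  have "\<exists>K. \<forall>p\<in>I \<times> {1..}. \<forall>\<epsilon>\<in>{0<..1}. \<exists>\<Phi>\<in>anns. \<exists>k\<ge>1. \<exists>l\<ge>1.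
      {f p, realization a \<Phi>} \<subseteq> cont_maps k l \<and>
      real (params \<Phi>) \<le> K * \<epsilon> powr (- (r(Suc N := \<rho>)) 0) *
        (\<Prod>l=1..Suc N. \<bar>real (dim_tensor_id N d p l)\<bar> powr (r(Suc N := \<rho>)) l) \<and>
      (SUP x\<in>carrier_vec k.
        ereal (w (vnorm x) * vnorm (the (f p x) - the (realization a \<Phi> x)))) \<le> ereal \<epsilon>"
    using f unfolding approx_space_def by blast
  \<comment> \<open>The constant \<open>K\<close> is uniform in \<open>i\<close>, \<open>n\<close>
    and \<open>\<epsilon>\<close>, so \<open>n\<close> may be chosen depending on \<open>i\<close>
    and \<open>\<epsilon>\<close>.\<close>
  then obtain K where K: "\<exists>\<Phi>\<in>anns. \<exists>k\<ge>1. \<exists>l\<ge>1.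
      {f (i, n), realization a \<Phi>} \<subseteq> cont_maps k l \<and>
      real (params \<Phi>) \<le> K * \<epsilon> powr (- (r(Suc N := \<rho>)) 0) * (P i * real n powr \<rho>) \<and>
      (SUP x\<in>carrier_vec k.
        ereal (w (vnorm x) * vnorm (the (f (i, n) x) - the (realization a \<Phi> x)))) \<le> ereal \<epsilon>"
    if "i \<in> I" "1 \<le> n" "\<epsilon> \<in> {0<..1}" for i n \<epsilon>
    unfolding dtp[symmetric] by blast
  \<comment> \<open>The factors come, in order, from a possibly negative \<open>K\<close>, from the
    accuracy \<open>\<epsilon> / 2\<close>, from rounding \<open>n\<close> up, and from the constant
    part of \<open>X\<close>.\<close>
  define K' where "K' = \<bar>K\<bar> * 2 powr r 0 * 2 powr \<rho> * (2 * C) powr (\<rho> / R)"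
  define s where "s = (\<lambda>l. if l = 0 then r 0 + \<rho> / R else r l + \<rho> * \<alpha> l / R)"
  have "\<exists>\<Phi>\<in>anns. \<exists>k\<ge>1. \<exists>l\<ge>1. {g i, realization a \<Phi>} \<subseteq> cont_maps k l \<and>
      real (params \<Phi>) \<le> K' * \<epsilon> powr (- s 0) * (\<Prod>l=1..N. \<bar>real (d i l)\<bar> powr s l) \<and>
      (SUP x\<in>carrier_vec k.
        ereal (w (vnorm x) * vnorm (the (g i x) - the (realization a \<Phi> x)))) \<le> ereal \<epsilon>"
    if i: "i \<in> I" and \<epsilon>: "\<epsilon> \<in> {0<..1}" for i \<epsilon>
  proof -
    \<comment> \<open>Chosen so that \<open>C * D i * inverse X = \<epsilon> / 2\<close>; hence
      \<open>real n powr (- R) \<le> inverse X\<close> leaves half of the error budget.\<close>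
    define X where "X = 2 * C * D i / \<epsilon>"
    have "1 * 1 \<le> C * D i"
      using C1 D1[OF i] by (intro mult_mono) auto
    then have X1: "1 \<le> X"
      using \<epsilon> by (simp add: X_def le_divide_eq)
    obtain n :: nat where n: "1 \<le> n" "real n powr (- R) \<le> inverse X"
        "real n powr \<rho> \<le> 2 powr \<rho> * X powr (\<rho> / R)"
      using exists_nat_powr_bounds[OF X1 R \<rho>] by blast
    have "\<epsilon> / 2 \<in> {0<..1}" using \<epsilon> by simp
    from K[OF i n(1) this] obtain \<Phi> k l where \<Phi>: "\<Phi> \<in> anns" "1 \<le> k" "1 \<le> l"
        "f (i, n) \<in> cont_maps k l" "realization a \<Phi> \<in> cont_maps k l"
      and par: "real (params \<Phi>) \<le> K * (\<epsilon> / 2) powr (- r 0) * (P i * real n powr \<rho>)"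
      and err: "(SUP x\<in>carrier_vec k.
          ereal (w (vnorm x) * vnorm (the (f (i, n) x) - the (realization a \<Phi> x)))) \<le> ereal (\<epsilon> / 2)"
      by auto
    have fi: "f (i, n) \<in> cont_maps (dim_in i) (dim_out i)" "g i \<in> cont_maps (dim_in i) (dim_out i)"
      using fg i n(1) by auto
    note kl = cont_maps_dims_unique[OF fi(1) \<Phi>(4)]
    have gi: "g i \<in> cont_maps k l" using fi(2) kl by simp

    have "w (vnorm x) * vnorm (the (g i x) - the (realization a \<Phi> x)) \<le> \<epsilon>"
      if x: "x \<in> carrier_vec k" for x
    proof -
      have w0: "0 \<le> w (vnorm x)" using w vnorm_nonneg by auto
      have "C * D i * real n powr (- R) \<le> C * D i * inverse X"
        using n(2) C1 D1[OF i] by (intro mult_left_mono) auto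
      also have "\<dots> = \<epsilon> / 2"
        using C1 D1[OF i] \<epsilon> by (simp add: X_def)
      finally have 1: "w (vnorm x) * vnorm (the (g i x) - the (f (i, n) x)) \<le> \<epsilon> / 2"
        using fg_le[OF i n(1), of x] x kl by simp
      have 2: "w (vnorm x) * vnorm (the (f (i, n) x) - the (realization a \<Phi> x)) \<le> \<epsilon> / 2"
        using err x by (simp add: SUP_le_iff)
      \<comment> \<open>The triangle inequality passes through \<open>f (i, n)\<close>; all three
        values lie in \<open>carrier_vec l\<close> because \<open>k\<close> and \<open>l\<close>
        agree with the dimensions of \<open>g i\<close>.\<close>
      have "vnorm (the (g i x) - the (realization a \<Phi> x)) \<le>
          vnorm (the (g i x) - the (f (i, n) x)) + vnorm (the (f (i, n) x) - the (realization a \<Phi> x))"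
        using cont_mapsD(2) gi \<Phi>(4,5) x by (intro vnorm_diff_triangle[of _ l]) blast+
      from mult_left_mono[OF this w0] 1 2 show ?thesis
        by (simp add: distrib_left)
    qed
    then have err': "(SUP x\<in>carrier_vec k.
        ereal (w (vnorm x) * vnorm (the (g i x) - the (realization a \<Phi> x)))) \<le> ereal \<epsilon>"
      by (simp add: SUP_le_iff)

    \<comment> \<open>With \<open>\<bar>K\<bar>\<close> the coefficient is nonnegative, so the upper
      bound for \<open>real n powr \<rho>\<close> can be inserted next.\<close>
    have "real (params \<Phi>) \<le> \<bar>K\<bar> * (\<epsilon> / 2) powr (- r 0) * (P i * real n powr \<rho>)"
      by (rule order_trans[OF par]) (intro mult_right_mono, auto simp: P0)
    also have "\<dots> \<le> \<bar>K\<bar> * (\<epsilon> / 2) powr (- r 0) * (P i * (2 powr \<rho> * X powr (\<rho> / R)))"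
      using n(3) P0 by (intro mult_left_mono) auto
    also have "(\<epsilon> / 2) powr (- r 0) = 2 powr r 0 * \<epsilon> powr (- r 0)"
      using \<epsilon> by (simp add: powr_divide powr_minus field_simps)
    also have "X powr (\<rho> / R) = (2 * C) powr (\<rho> / R) * D i powr (\<rho> / R) * \<epsilon> powr (- (\<rho> / R))"
    proof -
      have "X = (2 * C) * D i * inverse \<epsilon>" by (simp add: X_def divide_inverse)
      then show ?thesis
        using C1 D1[OF i] \<epsilon> by (simp add: powr_mult powr_minus inverse_powr)
    qed
    \<comment> \<open>Raising the product to the power \<open>\<rho> / R\<close> turns each exponent
      \<open>\<alpha> l\<close> into the increment \<open>\<rho> * \<alpha> l / R\<close>.\<close>
    also have "D i powr (\<rho> / R) = (\<Prod>l=1..N. \<bar>real (d i l)\<bar> powr (\<rho> * \<alpha> l / R))"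
      by (simp add: D_def prod_powr_distrib powr_powr mult.commute)
    also have "\<bar>K\<bar> * (2 powr r 0 * \<epsilon> powr (- r 0)) * (P i * (2 powr \<rho> * ((2 * C) powr (\<rho> / R) *
          (\<Prod>l=1..N. \<bar>real (d i l)\<bar> powr (\<rho> * \<alpha> l / R)) * \<epsilon> powr (- (\<rho> / R)))))
        = K' * (\<epsilon> powr (- r 0) * \<epsilon> powr (- (\<rho> / R))) *
          (P i * (\<Prod>l=1..N. \<bar>real (d i l)\<bar> powr (\<rho> * \<alpha> l / R)))"
      by (simp add: K'_def mult_ac)
    \<comment> \<open>The powers of \<open>\<epsilon>\<close> merge, and so do the powers of each
      dimension once \<open>P i\<close> and the other product are joined factor by factor.\<close>
    also have "\<dots> = K' * \<epsilon> powr (- (r 0 + \<rho> / R)) *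
        (\<Prod>l=1..N. \<bar>real (d i l)\<bar> powr (r l + \<rho> * \<alpha> l / R))"
      by (simp only: P_def powr_add minus_add_distrib prod.distrib)
    also have "\<dots> = K' * \<epsilon> powr (- s 0) * (\<Prod>l=1..N. \<bar>real (d i l)\<bar> powr s l)"
      by (simp add: s_def)
    finally show ?thesis
      using \<Phi> gi err' by blast
  qed
  then have "g \<in> approx_space a w N s I d"
    using g unfolding approx_space_def by blast
  then show ?thesis
    by (simp only: s_def)
qed

end
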